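(* Let $E$ be a locally convex space. Then the following assertions are equivalent: (i) $E$ has the strong Gelfand--Phillips property. (ii) There exists a null sequence $\{\chi_n\}_{n\in\omega}$ in $E'_{w^\ast}$ such that for any infinite barrel-bounded, barrel-separated subset $D$ of $E$ there are an infinite subset $D_0\subseteq D$ and $\delta>0$ such that $$\sup_{n\in\omega}|\chi_n(x-x')|>\delta\quad\text{for every distinct } x,x'\in D_0.$$ (iii) There is a continuous linear operator $T:E\to C_p^0(\omega)$ such that for any infinite barrel-bounded, barrel-separated set $D$ in $E$, the set $T(D)$ is not precompact in the Banach space $c_0$.
   Context: All locally convex spaces are Hausdorff and infinite-dimensional over the field $\mathbb{F}$ of real or complex numbers. $E'$ is the space of continuous linear functionals on $E$, and $E'_{w^\ast}$ is $E'$ with the weak$^\ast$ topology $\sigma(E',E)$. A barrel is a closed absolutely convex absorbing subset. A set $B\subseteq E$ is barrel-bounded if for every barrel $U\subseteq E$ there is $n\in\omega$ with $B\subseteq nU$. A set $A\subseteq E$ is barrel-precompact if for every barrel $U\subseteq E$ there is a finite set $F\subseteq E$ with $A\subseteq F+U$. A set $D\subseteq E$ is barrel-separated if there is a barrel $U\subseteq E$ such that $x-x'\notin U$ for all distinct $x,x'\in D$. A subset $A$ of a locally convex space $E$ is precompact if for every neighborhood $V$ of zero there is a finite $F\subseteq E$ with $A\subseteq F+V$ (i.e. totally bounded). For $B\subseteq E$ and $\chi\in E'$, $\|\chi\|_B:=\sup\{|\chi(x)|:x\in B\cup\{0\}\}$. $E$ has the strong Gelfand--Phillips property if there is a weak$^\ast$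 null sequence $\{\chi_n\}_{n\in\omega}$ in $E'$ such that $\|\chi_n\|_B\not\to 0$ for every barrel-bounded set $B\subseteq E$ which is not barrel-precompact. $c_0$ is the Banach space of null sequences in $\mathbb{F}^\omega$ with the sup-norm, and $C_p^0(\omega)$ is the same vector space with the topology of pointwise (coordinatewise) convergence. *)

theory Defs
  imports "HOL-Analysis.Analysis"
begin

text \<open>
  The scalar field is the real or the complex numbers, up to an isomorphism
  preserving the absolute value.
\<close>

class real_or_complex = real_normed_field +
  assumes real_or_complex:
    "\<exists>f :: 'a \<Rightarrow> complex.
       (\<forall>x y. f (x + y) = f x + f y) \<and> (\<forall>x y. f (x * y) = f x * f y) \<and>
       (\<forall>x. cmod (f x) = norm x) \<and> (range f = \<real> \<or> range f = UNIV)"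

instance real :: real_or_complex
  by standard (rule exI[of _ complex_of_real], auto simp: Reals_def)

instance complex :: real_or_complex
  by standard (rule exI[of _ "\<lambda>z. z"], auto)

definition convex_set :: "('k::real_or_complex \<Rightarrow> 'a::ab_group_add \<Rightarrow> 'a) \<Rightarrow> 'a set \<Rightarrow> bool" where
  "convex_set smul A \<longleftrightarrow>
     (\<forall>x\<in>A. \<forall>y\<in>A. \<forall>t::real. 0 \<le> t \<and> t \<le> 1 \<longrightarrow>
        smul (of_real t) x + smul (of_real (1 - t)) y \<in> A)"

definition balanced :: "('k::real_or_complex \<Rightarrow> 'a::ab_group_add \<Rightarrow> 'a) \<Rightarrow> 'a set \<Rightarrow> bool" where
  "balanced smul A \<longleftrightarrow> (\<forall>c. norm c \<le> 1 \<longrightarrow> smul c ` A \<subseteq> A)"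

definition absorbing :: "('k::real_or_complex \<Rightarrow> 'a::ab_group_add \<Rightarrow> 'a) \<Rightarrow> 'a set \<Rightarrow> bool" where
  "absorbing smul A \<longleftrightarrow> (\<forall>x. \<exists>r>0. \<forall>c. r \<le> norm c \<longrightarrow> x \<in> smul c ` A)"

definition absolutely_convex :: "('k::real_or_complex \<Rightarrow> 'a::ab_group_add \<Rightarrow> 'a) \<Rightarrow> 'a set \<Rightarrow> bool" where
  "absolutely_convex smul A \<longleftrightarrow> convex_set smul A \<and> balanced smul A"

text \<open>
  The space is the whole type \<open>'a\<close>; its Hausdorff group topology comes from the type class.
  Infinite-dimensionality is part of the convention.
\<close>

locale locally_convex_space = vector_space smul
  for smul :: "'k::real_or_complex \<Rightarrow> 'a::{topological_ab_group_add, t2_space} \<Rightarrow> 'a" +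
  assumes continuous_smul: "continuous_on UNIV (\<lambda>(c, x). smul c x)"
    and locally_convex:
      "\<And>V. 0 \<in> interior V \<Longrightarrow> \<exists>W. 0 \<in> interior W \<and> W \<subseteq> V \<and> convex_set smul W"
    and infinite_dimensional: "\<not> (\<exists>B. finite B \<and> span B = UNIV)"

definition precompact :: "'a::{ab_group_add, topological_space} set \<Rightarrow> bool" where
  "precompact A \<longleftrightarrow>
     (\<forall>V. 0 \<in> interior V \<longrightarrow> (\<exists>F. finite F \<and> A \<subseteq> (\<Union>x\<in>F. (+) x ` V)))"

definition barrel ::
    "('k::real_or_complex \<Rightarrow> 'a::{ab_group_add, topological_space} \<Rightarrow> 'a) \<Rightarrow> 'a set \<Rightarrow> bool" where
  "barrel smul U \<longleftrightarrow> closed U \<and> absolutely_convex smul U \<and> absorbing smul U"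

definition barrel_bounded ::
    "('k::real_or_complex \<Rightarrow> 'a::{ab_group_add, topological_space} \<Rightarrow> 'a) \<Rightarrow> 'a set \<Rightarrow> bool" where
  "barrel_bounded smul B \<longleftrightarrow>
     (\<forall>U. barrel smul U \<longrightarrow> (\<exists>n::nat. B \<subseteq> smul (of_nat n) ` U))"

definition barrel_precompact ::
    "('k::real_or_complex \<Rightarrow> 'a::{ab_group_add, topological_space} \<Rightarrow> 'a) \<Rightarrow> 'a set \<Rightarrow> bool" where
  "barrel_precompact smul A \<longleftrightarrow>
     (\<forall>U. barrel smul U \<longrightarrow> (\<exists>F. finite F \<and> A \<subseteq> (\<Union>x\<in>F. (+) x ` U)))"

definition barrel_separated ::
    "('k::real_or_complex \<Rightarrow> 'a::{ab_group_add, topological_space} \<Rightarrow> 'a) \<Rightarrow> 'a set \<Rightarrow> bool" where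
  "barrel_separated smul D \<longleftrightarrow>
     (\<exists>U. barrel smul U \<and> (\<forall>x\<in>D. \<forall>x'\<in>D. x \<noteq> x' \<longrightarrow> x - x' \<notin> U))"

definition dual ::
    "('k::real_or_complex \<Rightarrow> 'a::{ab_group_add, topological_space} \<Rightarrow> 'a) \<Rightarrow> ('a \<Rightarrow> 'k) set" where
  "dual smul = {\<phi>. Vector_Spaces.linear smul (*) \<phi> \<and> continuous_on UNIV \<phi>}"

text \<open>The topology \<open>\<sigma>(E', E)\<close> is the topology of pointwise convergence on \<open>E\<close>.\<close>

definition weak_star_topology ::
    "('k::real_or_complex \<Rightarrow> 'a::{ab_group_add, topological_space} \<Rightarrow> 'a) \<Rightarrow> ('a \<Rightarrow> 'k) topology" where
  "weak_star_topology smul = subtopology (product_topology (\<lambda>_. euclidean) UNIV) (dual smul)"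

definition weak_star_null ::
    "('k::real_or_complex \<Rightarrow> 'a::{ab_group_add, topological_space} \<Rightarrow> 'a) \<Rightarrow> (nat \<Rightarrow> 'a \<Rightarrow> 'k) \<Rightarrow> bool" where
  "weak_star_null smul \<phi> \<longleftrightarrow>
     range \<phi> \<subseteq> dual smul \<and> limitin (weak_star_topology smul) \<phi> (\<lambda>_. 0) sequentially"

text \<open>
  The supremum is taken in the reals. It is only used for barrel-bounded \<open>B\<close> and continuous
  linear \<open>\<phi>\<close>, where it is finite because \<open>{x. norm (\<phi> x) \<le> 1}\<close> is a barrel.
\<close>

definition sup_on :: "'a::zero set \<Rightarrow> ('a \<Rightarrow> 'k::real_normed_vector) \<Rightarrow> real" where
  "sup_on B \<phi> = (SUP x\<in>B \<union> {0}. norm (\<phi> x))"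

definition strong_Gelfand_Phillips ::
    "('k::real_or_complex \<Rightarrow> 'a::{ab_group_add, topological_space} \<Rightarrow> 'a) \<Rightarrow> bool" where
  "strong_Gelfand_Phillips smul \<longleftrightarrow>
     (\<exists>\<phi>. weak_star_null smul \<phi> \<and>
       (\<forall>B. barrel_bounded smul B \<and> \<not> barrel_precompact smul B \<longrightarrow>
          \<not> (\<lambda>n. sup_on B (\<phi> n)) \<longlonglongrightarrow> 0))"

typedef (overloaded) 'k c0 = "{x :: nat \<Rightarrow> 'k::real_normed_vector. x \<longlonglongrightarrow> 0}"
  morphisms coord Abs_c0
  by (rule exI[of _ "\<lambda>_. 0"]) simp

setup_lifting type_definition_c0

lemma coord_tendsto_0: "coord x \<longlonglongrightarrow> 0"
  using coord[of x] by simp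

lemma bdd_above_coord: "bdd_above (range (\<lambda>n. norm (coord x n)))"
  using convergent_imp_bounded[OF coord_tendsto_0[of x]]
  by (auto simp: bounded_iff bdd_above_def)

instantiation c0 :: (real_normed_vector) real_normed_vector
begin

lift_definition zero_c0 :: "'a c0" is "\<lambda>_. 0"
  by simp

lift_definition plus_c0 :: "'a c0 \<Rightarrow> 'a c0 \<Rightarrow> 'a c0" is "\<lambda>x y n. x n + y n"
  by (rule tendsto_add_zero)

lift_definition uminus_c0 :: "'a c0 \<Rightarrow> 'a c0" is "\<lambda>x n. - x n"
  using tendsto_minus by fastforce

lift_definition minus_c0 :: "'a c0 \<Rightarrow> 'a c0 \<Rightarrow> 'a c0" is "\<lambda>x y n. x n - y n"
  using tendsto_diff by fastforce

lift_definition scaleR_c0 :: "real \<Rightarrow> 'a c0 \<Rightarrow> 'a c0" is "\<lambda>r x n. r *\<^sub>R x n"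
  using tendsto_scaleR[OF tendsto_const] by fastforce

definition norm_c0 :: "'a c0 \<Rightarrow> real" where
  "norm_c0 x = (SUP n. norm (coord x n))"

definition dist_c0 :: "'a c0 \<Rightarrow> 'a c0 \<Rightarrow> real" where
  "dist_c0 x y = norm (x - y)"

definition sgn_c0 :: "'a c0 \<Rightarrow> 'a c0" where
  "sgn_c0 x = inverse (norm x) *\<^sub>R x"

definition uniformity_c0 :: "('a c0 \<times> 'a c0) filter" where
  "uniformity_c0 = (INF e\<in>{0<..}. principal {(x, y). dist x y < e})"

definition open_c0 :: "'a c0 set \<Rightarrow> bool" where
  "open_c0 U \<longleftrightarrow> (\<forall>x\<in>U. \<forall>\<^sub>F (x', y) in uniformity. x' = x \<longrightarrow> y \<in> U)"

instance
proof
  fix x y z :: "'a c0" and r s :: real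
  show "x + y + z = x + (y + z)" "x + y = y + x" "0 + x = x" "- x + x = 0" "x - y = x + - y"
    "r *\<^sub>R (x + y) = r *\<^sub>R x + r *\<^sub>R y" "(r + s) *\<^sub>R x = r *\<^sub>R x + s *\<^sub>R x"
    "r *\<^sub>R s *\<^sub>R x = (r * s) *\<^sub>R x" "1 *\<^sub>R x = x"
    by (transfer; simp add: algebra_simps; fail)+
  show "dist x y = norm (x - y)" by (rule dist_c0_def)
  show "sgn x = inverse (norm x) *\<^sub>R x" by (rule sgn_c0_def)
  show "uniformity = (INF e\<in>{0<..}. principal {(x, y :: 'a c0). dist x y < e})"
    by (rule uniformity_c0_def)
  show "open U \<longleftrightarrow> (\<forall>x\<in>U. \<forall>\<^sub>F (x', y) in uniformity. x' = x \<longrightarrow> y \<in> U)" for U :: "'a c0 set"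
    by (rule open_c0_def)
  have le: "norm (coord v n) \<le> norm v" for v :: "'a c0" and n
    unfolding norm_c0_def by (rule cSUP_upper[OF _ bdd_above_coord]) simp
  show "norm x = 0 \<longleftrightarrow> x = 0"
  proof
    assume "norm x = 0"
    then have "coord x n = 0" for n using le[of x n] by simp
    then show "x = 0" by (simp add: coord_inject[symmetric] zero_c0.rep_eq fun_eq_iff)
  next
    assume "x = 0"
    then show "norm x = 0" by (simp add: norm_c0_def zero_c0.rep_eq)
  qed
  show "norm (x + y) \<le> norm x + norm y"
    unfolding norm_c0_def[of "x + y"]
  proof (rule cSUP_least)
    show "norm (coord (x + y) n) \<le> norm x + norm y" for n
      using norm_triangle_ineq[of "coord x n" "coord y n"] le[of x n] le[of y n]
      by (simp add: plus_c0.rep_eq)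
  qed simp
  show "norm (r *\<^sub>R x) = \<bar>r\<bar> * norm x"
  proof (rule antisym)
    show "norm (r *\<^sub>R x) \<le> \<bar>r\<bar> * norm x"
      unfolding norm_c0_def[of "r *\<^sub>R x"]
      by (rule cSUP_least) (auto simp: scaleR_c0.rep_eq intro: mult_left_mono[OF le])
    show "\<bar>r\<bar> * norm x \<le> norm (r *\<^sub>R x)"
    proof (cases "r = 0")
      case True
      then show ?thesis using order_trans[OF norm_ge_zero le[of "r *\<^sub>R x" 0]] by simp
    next
      case False
      have "norm x \<le> norm (r *\<^sub>R x) / \<bar>r\<bar>"
        unfolding norm_c0_def[of x]
      proof (rule cSUP_least)
        show "norm (coord x n) \<le> norm (r *\<^sub>R x) / \<bar>r\<bar>" for n
          using le[of "r *\<^sub>R x" n] False by (simp add: scaleR_c0.rep_eq field_simps)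
      qed simp
      then show ?thesis using False by (simp add: field_simps)
    qed
  qed
qed

end

lift_definition scale_c0 :: "'k::real_normed_field \<Rightarrow> 'k c0 \<Rightarrow> 'k c0" is "\<lambda>c x n. c * x n"
  by (rule tendsto_mult_right_zero)

text \<open>
  The type-class topology of \<open>'k c0\<close> is the sup-norm topology. The space \<open>C\<^sub>p\<^sup>0(\<omega>)\<close> is the same
  vector space with the topology of pointwise convergence.
\<close>

definition Cp0_topology :: "'k::real_normed_vector c0 topology" where
  "Cp0_topology = pullback_topology UNIV coord (product_topology (\<lambda>_. euclidean) UNIV)"

end

theory Submission
  imports Defs
begin

text \<open>
  A null sequence \<open>\<phi>\<close> in \<open>E'\<close> with the weak* topology is the same thing as a continuous operator
  \<open>T x = (\<phi>\<^sub>n x)\<^sub>n\<close> into \<open>C\<^sub>p\<^sup>0(\<omega>)\<close>. A bounded subset of \<open>c\<^sub>0\<close> is precompact iff its coordinates tend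
  to \<open>0\<close> uniformly, so for a barrel-bounded \<open>B\<close> the set \<open>T(B)\<close> is precompact iff
  \<open>\<parallel>\<phi>\<^sub>n\<parallel>\<^sub>B \<rightarrow> 0\<close>. Infinite barrel-separated sets are not barrel-precompact, and every set that is not
  barrel-precompact contains one; this gives (i) iff (iii). Finally, a set in a metric space fails
  to be precompact iff it contains an infinite uniformly separated subset, which pulls back
  along \<open>T\<close>; this gives (ii) iff (iii).
\<close>

section \<open>Separated subsets and precompactness in normed spaces\<close>

text \<open>Greedy choice: \<open>ex\<close> always supplies a point unrelated to the finitely many
  already chosen. Symmetry removes the dependence on the order of choice, and reflexivity makes the
  enumeration injective, hence its range infinite. Applied below both to small distances and to
  differences lying in a barrel.\<close>

lemma infinite_separated_subset:
  assumes refl: "\<And>x. x \<in> A \<Longrightarrow> R x x" and sym: "\<And>x y. R x y \<Longrightarrow> R y x"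
    and ex: "\<And>F. finite F \<Longrightarrow> F \<subseteq> A \<Longrightarrow> \<exists>x\<in>A. \<forall>y\<in>F. \<not> R y x"
  shows "\<exists>D\<subseteq>A. infinite D \<and> (\<forall>x\<in>D. \<forall>y\<in>D. x \<noteq> y \<longrightarrow> \<not> R x y)"
proof -
  let ?Q = "\<lambda>f i r. r \<in> A \<and> (\<forall>j<(i::nat). \<not> R (f j) r)"
  have "\<exists>f. \<forall>i. ?Q f i (f i)"
  proof (rule dependent_wellorder_choice[where P = ?Q])
    fix i and f :: "nat \<Rightarrow> 'a"
    assume "\<And>j. j < i \<Longrightarrow> ?Q f j (f j)"
    then have "f ` {..<i} \<subseteq> A" by blast
    then obtain r where "r \<in> A" "\<forall>y\<in>f ` {..<i}. \<not> R y r"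
      using ex[of "f ` {..<i}"] by (meson finite_imageI finite_lessThan)
    then show "\<exists>r. ?Q f i r"
      by (intro exI[of _ r]) simp
  qed simp
  then obtain f where "\<forall>i. ?Q f i (f i)" ..
  then have f: "\<And>i. f i \<in> A" "\<And>i j. j < i \<Longrightarrow> \<not> R (f j) (f i)"
    by blast+
  have sep: "\<not> R (f i) (f j)" if "i \<noteq> j" for i j
  proof (cases "i < j")
    case True
    then show ?thesis by (rule f(2))
  next
    case False
    then have "j < i" using that by simp
    then show ?thesis using f(2)[of j i] sym[of "f i" "f j"] by blast
  qed
  have "inj f"
  proof (rule injI, rule ccontr)
    fix i j assume "f i = f j" "i \<noteq> j"
    then show False using sep[of i j] refl[OF f(1)[of j]] by simp
  qed
  then have "infinite (range f)"
    by (rule range_inj_infinite)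
  moreover have "\<forall>x\<in>range f. \<forall>y\<in>range f. x \<noteq> y \<longrightarrow> \<not> R x y"
  proof (intro ballI impI)
    fix x y assume "x \<in> range f" "y \<in> range f" "x \<noteq> y"
    then obtain i j where "x = f i" "y = f j" "i \<noteq> j" by blast
    then show "\<not> R x y" by (simp add: sep)
  qed
  moreover have "range f \<subseteq> A"
    using f(1) by blast
  ultimately show ?thesis
    by (intro exI[of _ "range f"] conjI)
qed

text \<open>Balls around zero form a neighbourhood base and their translates are balls, so the
  group-theoretic definition becomes metric total boundedness.\<close>

lemma precompact_iff_balls:
  fixes A :: "'a::real_normed_vector set"
  shows "precompact A \<longleftrightarrow> (\<forall>e>0. \<exists>F. finite F \<and> A \<subseteq> (\<Union>x\<in>F. ball x e))"
proof -
  have translate: "(+) x ` ball 0 e = ball x e" for x :: 'a and e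
    by (rule ball_translation[of x 0 e, unfolded add_0_right, symmetric])
  show ?thesis
  proof
    assume A: "precompact A"
    show "\<forall>e>0. \<exists>F. finite F \<and> A \<subseteq> (\<Union>x\<in>F. ball x e)"
    proof (intro allI impI)
      fix e :: real
      assume "e > 0"
      then have "0 \<in> interior (ball (0::'a) e)"
        by simp
      with A[unfolded precompact_def, THEN spec, of "ball 0 e"]
      have "\<exists>F. finite F \<and> A \<subseteq> (\<Union>x\<in>F. (+) x ` ball 0 e)"
        by (rule mp)
      then show "\<exists>F. finite F \<and> A \<subseteq> (\<Union>x\<in>F. ball x e)"
        by (simp only: translate)
    qed
  next
    assume A: "\<forall>e>0. \<exists>F. finite F \<and> A \<subseteq> (\<Union>x\<in>F. ball x e)"
    show "precompact A"
      unfolding precompact_def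
    proof (intro allI impI)
      fix V :: "'a set"
      assume "0 \<in> interior V"
      then obtain e where e: "e > 0" "ball 0 e \<subseteq> V"
        by (auto simp: mem_interior)
      obtain F where F: "finite F" "A \<subseteq> (\<Union>x\<in>F. ball x e)"
        using A e(1) by blast
      have "ball x e \<subseteq> (+) x ` V" for x
        using image_mono[OF e(2), of "(+) x"] by (simp only: translate)
      then have "(\<Union>x\<in>F. ball x e) \<subseteq> (\<Union>x\<in>F. (+) x ` V)"
        by (intro UN_mono order_refl)
      with F show "\<exists>F. finite F \<and> A \<subseteq> (\<Union>x\<in>F. (+) x ` V)"
        by (meson order_trans)
    qed
  qed
qed

text \<open>The separated set is sought in the domain, as in (ii); since \<delta> is positive,
  \<open>T\<close> is automatically injective on \<open>D0\<close>. One direction is the greedy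
  choice, the other the pigeonhole principle.\<close>

lemma not_precompact_image_iff_separated:
  fixes T :: "'a \<Rightarrow> 'b::real_normed_vector"
  shows "\<not> precompact (T ` D) \<longleftrightarrow>
    (\<exists>D0 \<delta>. D0 \<subseteq> D \<and> infinite D0 \<and> \<delta> > 0 \<and>
      (\<forall>x\<in>D0. \<forall>x'\<in>D0. x \<noteq> x' \<longrightarrow> dist (T x) (T x') > \<delta>))"
proof
  assume "\<not> precompact (T ` D)"
  then obtain e where e: "e > 0" "\<And>F. finite F \<Longrightarrow> \<not> T ` D \<subseteq> (\<Union>x\<in>F. ball x e)"
    by (auto simp: precompact_iff_balls)
  have "\<exists>D0\<subseteq>D. infinite D0 \<and> (\<forall>x\<in>D0. \<forall>y\<in>D0. x \<noteq> y \<longrightarrow> \<not> dist (T x) (T y) < e)"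
  proof (rule infinite_separated_subset)
    fix F assume "finite F" "F \<subseteq> D"
    then show "\<exists>x\<in>D. \<forall>y\<in>F. \<not> dist (T y) (T x) < e"
      using e(2)[of "T ` F"] by auto
  qed (use e in \<open>auto simp: dist_commute\<close>)
  then obtain D0 where "D0 \<subseteq> D" "infinite D0"
    "\<And>x y. x \<in> D0 \<Longrightarrow> y \<in> D0 \<Longrightarrow> x \<noteq> y \<Longrightarrow> e \<le> dist (T x) (T y)"
    by (auto simp: not_less)
  then show "\<exists>D0 \<delta>. D0 \<subseteq> D \<and> infinite D0 \<and> \<delta> > 0 \<and>
      (\<forall>x\<in>D0. \<forall>x'\<in>D0. x \<noteq> x' \<longrightarrow> dist (T x) (T x') > \<delta>)"
    \<comment> \<open>The greedy choice only gives distances at least \<open>e\<close>; halving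
      makes the bound strict.\<close>
    using e(1) by (intro exI[of _ D0] exI[of _ "e / 2"]) force
next
  assume "\<exists>D0 \<delta>. D0 \<subseteq> D \<and> infinite D0 \<and> \<delta> > 0 \<and>
      (\<forall>x\<in>D0. \<forall>x'\<in>D0. x \<noteq> x' \<longrightarrow> dist (T x) (T x') > \<delta>)"
  then obtain D0 \<delta> where D0: "D0 \<subseteq> D" "infinite D0" "\<delta> > 0"
    "\<And>x x'. x \<in> D0 \<Longrightarrow> x' \<in> D0 \<Longrightarrow> x \<noteq> x' \<Longrightarrow> dist (T x) (T x') > \<delta>"
    by blast
  show "\<not> precompact (T ` D)"
  proof
    assume "precompact (T ` D)"
    then obtain F where F: "finite F" "T ` D \<subseteq> (\<Union>x\<in>F. ball x (\<delta> / 2))"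
      using D0(3) unfolding precompact_iff_balls by (meson half_gt_zero)
    then have "\<forall>x\<in>D0. \<exists>y. y \<in> F \<and> dist y (T x) < \<delta> / 2"
      using D0(1) by fastforce
    \<comment> \<open>\<open>g\<close> picks a centre for each point and sends the infinite
      \<open>D0\<close> into the finite \<open>F\<close>; two points with the same centre are closer
      than \<delta>.\<close>
    then obtain g where g: "\<And>x. x \<in> D0 \<Longrightarrow> g x \<in> F \<and> dist (g x) (T x) < \<delta> / 2"
      by metis
    then have "finite (g ` D0)"
      using F(1) by (meson finite_subset image_subsetI)
    then have "\<not> inj_on g D0"
      using D0(2) finite_imageD by blast
    then obtain x x' where x: "x \<in> D0" "x' \<in> D0" "x \<noteq> x'" "g x = g x'"
      by (auto simp: inj_on_def)
    then have "dist (T x) (T x') < \<delta>"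
      using g[of x] g[of x'] by (metis dist_commute dist_triangle_half_r)
    with D0(4) x show False by fastforce
  qed
qed

section \<open>Precompact sets in \<open>c0\<close>\<close>

text \<open>The class offers only an embedding \<open>f\<close> into the complex numbers. It is
  isometric with closed range, so compactness of complex discs can be carried back along it.\<close>

lemma cball_totally_bounded:
  fixes a :: real
  assumes "e > 0"
  shows "\<exists>F::'k::real_or_complex set. finite F \<and> cball 0 a \<subseteq> (\<Union>x\<in>F. ball x e)"
proof -
  obtain f :: "'k \<Rightarrow> complex" where f: "\<And>x y. f (x + y) = f x + f y" "\<And>x. cmod (f x) = norm x"
    "range f = \<real> \<or> range f = UNIV"
    using real_or_complex by blast
  have dist_f: "dist (f x) (f y) = dist x y" for x y
    using f(1)[of "x - y" y] f(2)[of "x - y"] by (simp add: dist_norm)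
  have "closed (range f)"
    using f(3) closed_complex_Reals by auto
  then have "compact (cball 0 a \<inter> range f)"
    by (simp add: compact_Int_closed)
  then obtain K where K: "finite K" "K \<subseteq> range f" "cball 0 a \<inter> range f \<subseteq> (\<Union>x\<in>K. ball x e)"
    using seq_compact_imp_totally_bounded[of "cball 0 a \<inter> range f"] assms
    by (auto simp: compact_eq_seq_compact_metric)
  \<comment> \<open>The net \<open>K\<close> consists of points of \<open>range f\<close>, so its
    centres can be pulled back.\<close>
  obtain F where F: "finite F" "K = f ` F"
    using finite_subset_image[OF K(1,2)] by auto
  have "cball 0 a \<subseteq> (\<Union>x\<in>F. ball x e)"
  proof
    fix y :: 'k assume "y \<in> cball 0 a"
    then have "f y \<in> cball 0 a \<inter> range f"
      using f(2) by simp
    then have "f y \<in> (\<Union>x\<in>K. ball x e)"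
      using K(3) by blast
    then show "y \<in> (\<Union>x\<in>F. ball x e)"
      by (simp add: F(2) dist_f)
  qed
  with F(1) show ?thesis by blast
qed

lemma norm_coord_le: "norm (coord x n) \<le> norm x"
  unfolding norm_c0_def by (rule cSUP_upper[OF _ bdd_above_coord]) simp

lemma norm_c0_leI: "(\<And>n. norm (coord x n) \<le> b) \<Longrightarrow> norm x \<le> b"
  unfolding norm_c0_def by (rule cSUP_least) auto

lemma coord_Abs_c0: "x \<longlonglongrightarrow> 0 \<Longrightarrow> coord (Abs_c0 x) = x"
  by (simp add: Abs_c0_inverse)

text \<open>Beyond some \<open>N\<close> all coordinates are uniformly small, and each of the first
  \<open>N\<close> runs in a disc with a finite net. Combining these nets and extending by zero
  gives a finite net in \<open>c0\<close>.\<close>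

lemma precompact_c0I:
  fixes A :: "'k::real_or_complex c0 set"
  assumes a: "\<And>x n. x \<in> A \<Longrightarrow> norm (coord x n) \<le> a n" and "a \<longlonglongrightarrow> 0"
  shows "precompact A"
  unfolding precompact_iff_balls
proof (intro allI impI)
  fix e :: real
  assume e: "e > 0"
  then obtain N where N: "\<And>n. n \<ge> N \<Longrightarrow> norm (a n) < e / 2"
    using LIMSEQ_D[OF \<open>a \<longlonglongrightarrow> 0\<close>, of "e / 2"] by auto
  have "\<exists>G. \<forall>n. finite (G n) \<and> cball (0::'k) (a n) \<subseteq> (\<Union>x\<in>G n. ball x (e / 2))"
    using e by (intro choice allI cball_totally_bounded) simp
  then obtain G where G: "\<And>n. finite (G n)"
    "\<And>n. cball (0::'k) (a n) \<subseteq> (\<Union>x\<in>G n. ball x (e / 2))"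
    by blast
  define trunc where "trunc h = Abs_c0 (\<lambda>n. if n < N then h n else (0::'k))" for h
  have coord_trunc: "coord (trunc h) = (\<lambda>n. if n < N then h n else 0)" for h
    unfolding trunc_def
    by (rule coord_Abs_c0)
      (auto intro!: tendsto_eventually eventually_sequentiallyI[of N])
  let ?F = "trunc ` (PiE {..<N} G)"
  have "finite ?F"
    using G(1) by (intro finite_imageI finite_PiE) auto
  moreover have "A \<subseteq> (\<Union>x\<in>?F. ball x e)"
  proof
    fix x assume x: "x \<in> A"
    have "\<exists>g. g \<in> G n \<and> norm (g - coord x n) < e / 2" for n
    proof -
      have "coord x n \<in> cball 0 (a n)"
        using a[OF x] by simp
      then have "coord x n \<in> (\<Union>x\<in>G n. ball x (e / 2))"
        using G(2) by blast
      then show ?thesis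
        by (auto simp: dist_norm)
    qed
    then have "\<exists>g. \<forall>n. g n \<in> G n \<and> norm (g n - coord x n) < e / 2"
      by (intro choice allI)
    then obtain g where g: "\<And>n. g n \<in> G n" "\<And>n. norm (g n - coord x n) < e / 2"
      by blast
    \<comment> \<open>Restricting \<open>g\<close> puts it into the finite product
      \<open>PiE {..<N} G\<close>; \<open>trunc\<close> ignores the other indices anyway.\<close>
    let ?y = "trunc (restrict g {..<N})"
    \<comment> \<open>A coordinatewise bound passes to the supremum only as a weak inequality, hence
      \<open>e / 2\<close> in place of \<open>e\<close>.\<close>
    have "norm (coord (?y - x) n) \<le> e / 2" for n
    proof (cases "n < N")
      case True
      then show ?thesis
        using g(2)[of n] by (simp add: minus_c0.rep_eq coord_trunc)
    next
      case False
      then show ?thesis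
        using a[OF x, of n] N[of n] by (simp add: minus_c0.rep_eq coord_trunc)
    qed
    then have "norm (?y - x) \<le> e / 2"
      by (rule norm_c0_leI)
    then have "x \<in> ball ?y e"
      using e by (simp add: dist_norm)
    moreover have "?y \<in> ?F"
      using g(1) by (intro imageI) (simp only: restrict_PiE_iff, blast)
    ultimately show "x \<in> (\<Union>x\<in>?F. ball x e)" by blast
  qed
  ultimately show "\<exists>F. finite F \<and> A \<subseteq> (\<Union>x\<in>F. ball x e)" by blast
qed

text \<open>Finitely many null sequences have uniformly small tails, and every point of
  \<open>A\<close> lies within \<open>e / 2\<close> of one of them.\<close>

lemma precompact_c0_uniform:
  assumes "precompact A" "e > 0"
  shows "\<forall>\<^sub>F n in sequentially. \<forall>x\<in>A. norm (coord x n) < e"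
proof -
  obtain F where F: "finite F" "A \<subseteq> (\<Union>x\<in>F. ball x (e / 2))"
    using assms unfolding precompact_iff_balls by (meson half_gt_zero)
  have "\<forall>\<^sub>F n in sequentially. norm (coord y n) < e / 2" for y :: "'a c0"
    using tendsto_norm[OF coord_tendsto_0[of y]] assms(2) by (intro order_tendstoD(2)) auto
  then have "\<forall>\<^sub>F n in sequentially. \<forall>y\<in>F. norm (coord y n) < e / 2"
    using F(1) by (simp add: eventually_ball_finite)
  then show ?thesis
  proof eventually_elim
    case (elim n)
    show ?case
    proof
      fix x assume "x \<in> A"
      then obtain y where y: "y \<in> F" "norm (y - x) < e / 2"
        using F(2) by (auto simp: dist_norm)
      have "norm (coord y n - coord x n) < e / 2"
        using norm_coord_le[of "y - x" n] y(2) by (simp add: minus_c0.rep_eq)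
      moreover have "norm (coord x n) \<le> norm (coord y n) + norm (coord y n - coord x n)"
        by (metis norm_minus_commute norm_triangle_sub)
      ultimately show "norm (coord x n) < e"
        using elim y(1) by fastforce
    qed
  qed
qed

section \<open>Weak* null sequences as operators into \<open>c0\<close> with the pointwise
  topology\<close>

lemma dual_linear:
  assumes "\<phi> \<in> dual smul"
  shows "\<phi> (x + y) = \<phi> x + \<phi> y" "\<phi> (smul c x) = c * \<phi> x" "\<phi> 0 = 0"
proof -
  interpret Vector_Spaces.linear smul "(*)" \<phi>
    using assms by (simp add: dual_def)
  show "\<phi> (x + y) = \<phi> x + \<phi> y" "\<phi> (smul c x) = c * \<phi> x" "\<phi> 0 = 0"
    by (simp_all add: add scale)
qed

lemma vector_space_mult: "vector_space ((*) :: 'k::field \<Rightarrow> 'k \<Rightarrow> 'k)"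
  by unfold_locales (simp_all add: algebra_simps)

lemma vector_space_scale_c0: "vector_space (scale_c0 :: 'k::real_normed_field \<Rightarrow> 'k c0 \<Rightarrow> 'k c0)"
  by unfold_locales (transfer; simp add: algebra_simps)+

lemma barrel_bounded_subset: "barrel_bounded smul B \<Longrightarrow> A \<subseteq> B \<Longrightarrow> barrel_bounded smul A"
  unfolding barrel_bounded_def by (meson order_trans)

context locally_convex_space
begin

lemma weak_star_null_iff:
  "weak_star_null smul \<phi> \<longleftrightarrow> (\<forall>n. \<phi> n \<in> dual smul) \<and> (\<forall>x. (\<lambda>n. \<phi> n x) \<longlonglongrightarrow> 0)"
proof -
  \<comment> \<open>Convergence in a subtopology requires the limit to belong to the subspace;
    beyond that it is convergence at each point.\<close>
  have "(\<lambda>_. 0) \<in> dual smul"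
    using vector_space_axioms vector_space_mult
    by (auto simp: dual_def Vector_Spaces.linear_iff)
  then show ?thesis
    unfolding weak_star_null_def weak_star_topology_def
    by (auto simp: limitin_subtopology limitin_componentwise)
qed

lemma continuous_map_Cp0_iff:
  "continuous_map euclidean Cp0_topology T \<longleftrightarrow> (\<forall>n. continuous_on UNIV (\<lambda>x. coord (T x) n))"
proof
  assume T: "continuous_map euclidean Cp0_topology T"
  have "continuous_map Cp0_topology (product_topology (\<lambda>_. euclidean) UNIV) (id \<circ> coord)"
    unfolding Cp0_topology_def by (intro continuous_map_pullback continuous_map_id)
  from continuous_map_compose[OF T this]
  show "\<forall>n. continuous_on UNIV (\<lambda>x. coord (T x) n)"
    by (simp add: continuous_map_componentwise_UNIV)
next
  assume "\<forall>n. continuous_on UNIV (\<lambda>x. coord (T x) n)"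
  then show "continuous_map euclidean Cp0_topology T"
    unfolding Cp0_topology_def
    by (intro continuous_map_pullback') (auto simp: continuous_map_componentwise_UNIV)
qed

text \<open>Linearity and continuity are both tested coordinate by coordinate, and pointwise
  convergence to zero is built into \<open>T\<close> taking values in \<open>c0\<close>.\<close>

lemma weak_star_null_coord_iff:
  fixes T :: "'a \<Rightarrow> 'k c0"
  assumes T: "\<And>x n. coord (T x) n = \<phi> n x"
  shows "weak_star_null smul \<phi> \<longleftrightarrow>
    Vector_Spaces.linear smul scale_c0 T \<and> continuous_map euclidean Cp0_topology T"
proof -
  have "coord (T x) = (\<lambda>n. \<phi> n x)" for x
    by (rule ext) (rule T)
  then have "(\<lambda>n. \<phi> n x) \<longlonglongrightarrow> 0" for x
    using coord_tendsto_0[of "T x"] by (simp only:)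
  moreover have "Vector_Spaces.linear smul scale_c0 T \<longleftrightarrow>
      (\<forall>n. Vector_Spaces.linear smul (*) (\<phi> n))"
    unfolding Vector_Spaces.linear_iff coord_inject[symmetric] fun_eq_iff
      plus_c0.rep_eq scale_c0.rep_eq T
    using vector_space_axioms vector_space_mult[where 'k='k]
      vector_space_scale_c0[where 'k='k]
    by blast
  moreover have "continuous_map euclidean Cp0_topology T \<longleftrightarrow> (\<forall>n. continuous_on UNIV (\<phi> n))"
    unfolding continuous_map_Cp0_iff T ..
  ultimately show ?thesis
    unfolding weak_star_null_iff dual_def by blast
qed

section \<open>Barrels, separation and barrel-precompactness\<close>

text \<open>This is the barrel \<open>U\<close> scaled by one half. As a preimage it is closed by
  continuity of scaling, and the other properties follow because scalars commute.\<close>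

lemma barrel_halve:
  assumes "barrel smul U"
  shows "barrel smul (smul 2 -` U)"
proof -
  have U: "closed U" "convex_set smul U" "balanced smul U" "absorbing smul U"
    using assms by (auto simp: barrel_def absolutely_convex_def)
  have "continuous_on UNIV ((\<lambda>(c, x). smul c x) \<circ> (\<lambda>x. (2::'k, x)))"
    by (intro continuous_on_compose continuous_intros continuous_on_subset[OF continuous_smul]) auto
  then have "closed (smul 2 -` U)"
    using U(1) by (intro closed_vimage) (simp_all add: o_def)
  moreover have "convex_set smul (smul 2 -` U)"
    unfolding convex_set_def
  proof (intro ballI allI impI)
    fix x y and t :: real
    assume "x \<in> smul 2 -` U" "y \<in> smul 2 -` U" "0 \<le> t \<and> t \<le> 1"
    then have "smul (of_real t) (smul 2 x) + smul (of_real (1 - t)) (smul 2 y) \<in> U"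
      using U(2) unfolding convex_set_def by blast
    then show "smul (of_real t) x + smul (of_real (1 - t)) y \<in> smul 2 -` U"
      by (simp only: vimage_eq scale_right_distrib scale_left_commute[of 2])
  qed
  moreover have "balanced smul (smul 2 -` U)"
    using U(3) unfolding balanced_def image_subset_iff vimage_eq
    by (simp only: scale_left_commute[of 2]) blast
  moreover have "absorbing smul (smul 2 -` U)"
    unfolding absorbing_def
  proof
    fix x
    obtain r where r: "r > 0" "\<And>c. r \<le> norm c \<Longrightarrow> smul 2 x \<in> smul c ` U"
      using U(4) unfolding absorbing_def by blast
    \<comment> \<open>The radius that absorbs \<open>smul 2 x\<close> into \<open>U\<close> also
      absorbs \<open>x\<close> into the halved barrel.\<close>
    have "x \<in> smul c ` (smul 2 -` U)" if c: "r \<le> norm c" for c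
    proof -
      obtain u where u: "u \<in> U" "smul 2 x = smul c u"
        using r(2)[OF c] by blast
      have "x = smul (1 / 2) (smul 2 x)" by simp
      also have "\<dots> = smul c (smul (1 / 2) u)"
        unfolding u(2) by (rule scale_left_commute)
      finally show ?thesis
        by (rule image_eqI) (use u(1) in simp)
    qed
    then show "\<exists>r>0. \<forall>c. r \<le> norm c \<longrightarrow> x \<in> smul c ` (smul 2 -` U)"
      using r(1) by blast
  qed
  ultimately show ?thesis
    by (simp add: barrel_def absolutely_convex_def)
qed

text \<open>The difference is the midpoint of \<open>smul 2 x\<close> and \<open>- smul 2 y\<close>.
  This plays the part of the triangle inequality for barrels.\<close>

lemma barrel_halve_diff:
  assumes "barrel smul U" "smul 2 x \<in> U" "smul 2 y \<in> U"
  shows "x - y \<in> U"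
proof -
  have U: "convex_set smul U" "balanced smul U"
    using assms(1) by (auto simp: barrel_def absolutely_convex_def)
  have "smul (- 1) (smul 2 y) \<in> U"
    using U(2)[unfolded balanced_def, rule_format, of "- 1"] assms(3) by auto
  with assms(2) have "smul (of_real (1 / 2)) (smul 2 x) + smul (of_real (1 - 1 / 2)) (smul (- 1) (smul 2 y)) \<in> U"
    by (intro U(1)[unfolded convex_set_def, rule_format]) auto
  then show ?thesis by simp
qed

lemma barrel_zero:
  assumes "barrel smul U"
  shows "0 \<in> U"
proof -
  have "absorbing smul U" "balanced smul U"
    using assms by (auto simp: barrel_def absolutely_convex_def)
  then obtain u where "u \<in> U"
    unfolding absorbing_def by (metis imageE norm_of_real abs_ge_self)
  then show ?thesis
    using \<open>balanced smul U\<close>[unfolded balanced_def, rule_format, of 0] by auto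
qed

lemma barrel_diff_commute:
  assumes "barrel smul U" "x - y \<in> U"
  shows "y - x \<in> U"
proof -
  have "balanced smul U"
    using assms by (auto simp: barrel_def absolutely_convex_def)
  then have "smul (- 1) (x - y) \<in> U"
    using assms(2) by (auto simp: balanced_def dest!: spec[of _ "- 1"])
  then show ?thesis by simp
qed

text \<open>Pigeonhole: if finitely many translates of the halved barrel covered \<open>D\<close>,
  two distinct points would share a translate and their difference would lie in
  \<open>U\<close>.\<close>

lemma barrel_separated_not_precompact:
  assumes "infinite D" "barrel_separated smul D"
  shows "\<not> barrel_precompact smul D"
proof
  assume D: "barrel_precompact smul D"
  obtain U where U: "barrel smul U" "\<And>x x'. x \<in> D \<Longrightarrow> x' \<in> D \<Longrightarrow> x \<noteq> x' \<Longrightarrow> x - x' \<notin> U"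
    using assms(2) unfolding barrel_separated_def by blast
  obtain F where F: "finite F" "D \<subseteq> (\<Union>x\<in>F. (+) x ` (smul 2 -` U))"
    using D barrel_halve[OF U(1)] unfolding barrel_precompact_def by blast
  then have "\<forall>x\<in>D. \<exists>y. y \<in> F \<and> smul 2 (x - y) \<in> U"
    by fastforce
  then obtain g where g: "\<And>x. x \<in> D \<Longrightarrow> g x \<in> F \<and> smul 2 (x - g x) \<in> U"
    by metis
  then have "finite (g ` D)"
    using F(1) by (meson finite_subset image_subsetI)
  then have "\<not> inj_on g D"
    using assms(1) finite_imageD by blast
  then obtain x x' where x: "x \<in> D" "x' \<in> D" "x \<noteq> x'" "g x = g x'"
    by (auto simp: inj_on_def)
  have "(x - g x) - (x' - g x') \<in> U"
    using g[OF x(1)] g[OF x(2)] by (intro barrel_halve_diff[OF U(1)]) blast+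
  then show False
    using U(2) x by simp
qed

text \<open>A barrel whose finitely many translates never cover \<open>B\<close> keeps the greedy
  choice going, with \<open>x - y \<in> U\<close> as the relation.\<close>

lemma not_barrel_precompact_separated_subset:
  assumes "\<not> barrel_precompact smul B"
  shows "\<exists>D\<subseteq>B. infinite D \<and> barrel_separated smul D"
proof -
  obtain U where U: "barrel smul U" "\<And>F. finite F \<Longrightarrow> \<not> B \<subseteq> (\<Union>x\<in>F. (+) x ` U)"
    using assms unfolding barrel_precompact_def by blast
  have "\<exists>D\<subseteq>B. infinite D \<and> (\<forall>x\<in>D. \<forall>y\<in>D. x \<noteq> y \<longrightarrow> \<not> x - y \<in> U)"
  proof (rule infinite_separated_subset)
    fix F :: "'a set" assume "finite F"
    then obtain x where x: "x \<in> B" "x \<notin> (\<Union>y\<in>F. (+) y ` U)"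
      using U(2) by blast
    have "y - x \<notin> U" if "y \<in> F" for y
    proof
      assume "y - x \<in> U"
      then have "x - y \<in> U" by (rule barrel_diff_commute[OF U(1)])
      then have "x \<in> (+) y ` U" by (intro image_eqI[of _ _ "x - y"]) auto
      with x(2) that show False by blast
    qed
    with x(1) show "\<exists>x\<in>B. \<forall>y\<in>F. \<not> y - x \<in> U" by blast
  qed (use U barrel_zero barrel_diff_commute in auto)
  then show ?thesis
    using U(1) unfolding barrel_separated_def by blast
qed

section \<open>Suprema of functionals over barrel-bounded sets\<close>

lemma barrel_polar:
  assumes "\<phi> \<in> dual smul"
  shows "barrel smul {x. norm (\<phi> x) \<le> 1}"
proof -
  note lin = dual_linear[OF assms]
  have "closed {x. norm (\<phi> x) \<le> 1}"
    using assms by (intro closed_Collect_le continuous_intros) (simp add: dual_def)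
  moreover have "convex_set smul {x. norm (\<phi> x) \<le> 1}"
    unfolding convex_set_def
  proof (intro ballI allI impI)
    fix x y and t :: real
    assume "x \<in> {x. norm (\<phi> x) \<le> 1}" "y \<in> {x. norm (\<phi> x) \<le> 1}" and t: "0 \<le> t \<and> t \<le> 1"
    then have x: "norm (\<phi> x) \<le> 1" "norm (\<phi> y) \<le> 1" by auto
    have "norm (of_real t * \<phi> x + of_real (1 - t) * \<phi> y)
        \<le> norm (of_real t * \<phi> x) + norm (of_real (1 - t) * \<phi> y)"
      by (rule norm_triangle_ineq)
    also have "\<dots> = t * norm (\<phi> x) + (1 - t) * norm (\<phi> y)"
      using t by (simp only: norm_mult norm_of_real) simp
    also have "\<dots> \<le> 1"
      using x t by (intro convex_bound_le) auto
    finally show "smul (of_real t) x + smul (of_real (1 - t)) y \<in> {x. norm (\<phi> x) \<le> 1}"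
      by (simp add: lin)
  qed
  moreover have "balanced smul {x. norm (\<phi> x) \<le> 1}"
    by (auto simp: balanced_def lin norm_mult mult_le_one)
  moreover have "absorbing smul {x. norm (\<phi> x) \<le> 1}"
    unfolding absorbing_def
  proof
    fix x
    \<comment> \<open>The summand 1 keeps \<open>c\<close> nonzero even when \<open>\<phi> x\<close>
      vanishes, so division by \<open>c\<close> is legitimate.\<close>
    have "x \<in> smul c ` {x. norm (\<phi> x) \<le> 1}" if c: "norm (\<phi> x) + 1 \<le> norm c" for c
    proof
      have "norm c > 0"
        using c norm_ge_zero[of "\<phi> x"] by linarith
      then show "x = smul c (smul (1 / c) x)" by simp
      show "smul (1 / c) x \<in> {x. norm (\<phi> x) \<le> 1}"
        using c \<open>norm c > 0\<close> by (simp add: lin norm_divide)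
    qed
    then show "\<exists>r>0. \<forall>c. r \<le> norm c \<longrightarrow> x \<in> smul c ` {x. norm (\<phi> x) \<le> 1}"
      by (intro exI[of _ "norm (\<phi> x) + 1"]) (auto simp: add_nonneg_pos)
  qed
  ultimately show ?thesis
    by (simp add: barrel_def absolutely_convex_def)
qed

text \<open>Barrel-boundedness tested on the barrel \<open>{x. norm (\<phi> x) \<le> 1}\<close>
  bounds \<phi> on \<open>B\<close>, so the real supremum is a genuine one.\<close>

lemma sup_on_upper:
  assumes "barrel_bounded smul B" "\<phi> \<in> dual smul" "x \<in> B \<union> {0}"
  shows "norm (\<phi> x) \<le> sup_on B \<phi>"
proof -
  obtain n :: nat where n: "B \<subseteq> smul (of_nat n) ` {x. norm (\<phi> x) \<le> 1}"
    using assms(1) barrel_polar[OF assms(2)] unfolding barrel_bounded_def by blast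
  have "norm (\<phi> y) \<le> real n" if y: "y \<in> B \<union> {0}" for y
  proof (cases "y = 0")
    case False
    then obtain z where z: "y = smul (of_nat n) z" "norm (\<phi> z) \<le> 1"
      using y n by blast
    then show ?thesis
      using mult_left_mono[OF z(2), of "real n"] by (simp add: dual_linear[OF assms(2)] norm_mult)
  qed (simp add: dual_linear[OF assms(2)])
  then have "bdd_above ((\<lambda>x. norm (\<phi> x)) ` (B \<union> {0}))"
    by (auto simp: bdd_above_def)
  then show ?thesis
    unfolding sup_on_def using assms(3) by (intro cSUP_upper)
qed

lemma precompact_image_iff_sup_on:
  fixes T :: "'a \<Rightarrow> 'k c0"
  assumes T: "\<And>x n. coord (T x) n = \<phi> n x" and \<phi>: "weak_star_null smul \<phi>"
    and B: "barrel_bounded smul B"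
  shows "precompact (T ` B) \<longleftrightarrow> (\<lambda>n. sup_on B (\<phi> n)) \<longlonglongrightarrow> 0"
proof
  have dual: "\<phi> n \<in> dual smul" for n
    using \<phi> by (simp add: weak_star_null_iff)
  show "precompact (T ` B)" if "(\<lambda>n. sup_on B (\<phi> n)) \<longlonglongrightarrow> 0"
    \<comment> \<open>The suprema themselves serve as the dominating null sequence.\<close>
    by (rule precompact_c0I[OF _ that]) (auto simp: T intro: sup_on_upper[OF B dual])
  assume pc: "precompact (T ` B)"
  show "(\<lambda>n. sup_on B (\<phi> n)) \<longlonglongrightarrow> 0"
  proof (rule tendstoI)
    fix e :: real
    assume e: "e > 0"
    then have "\<forall>\<^sub>F n in sequentially. \<forall>x\<in>T ` B. norm (coord x n) < e / 2"
      by (intro precompact_c0_uniform[OF pc]) simp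
    then show "\<forall>\<^sub>F n in sequentially. dist (sup_on B (\<phi> n)) 0 < e"
    proof eventually_elim
      case (elim n)
      have "sup_on B (\<phi> n) \<le> e / 2"
        unfolding sup_on_def
        using elim e by (intro cSUP_least) (auto simp: T dual_linear(3)[OF dual] less_imp_le)
      moreover have "0 \<le> sup_on B (\<phi> n)"
        using sup_on_upper[OF B dual[of n], of 0] by (simp add: dual_linear(3)[OF dual])
      ultimately show ?case
        using e by simp
    qed
  qed
qed

section \<open>Matching conditions on a null sequence with conditions on its operator\<close>

text \<open>From right to left, \<open>B\<close> is replaced by an infinite barrel-separated subset,
  which stays barrel-bounded and whose image inherits precompactness. Fixing \<phi> and
  \<open>T\<close> lets a witness for (i) serve for (iii) and conversely.\<close>

lemma detects_separated_iff:
  fixes T :: "'a \<Rightarrow> 'k c0"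
  assumes T: "\<And>x n. coord (T x) n = \<phi> n x" and \<phi>: "weak_star_null smul \<phi>"
  shows "(\<forall>B. barrel_bounded smul B \<and> \<not> barrel_precompact smul B \<longrightarrow>
        \<not> (\<lambda>n. sup_on B (\<phi> n)) \<longlonglongrightarrow> 0) \<longleftrightarrow>
      (\<forall>D. infinite D \<and> barrel_bounded smul D \<and> barrel_separated smul D \<longrightarrow>
        \<not> precompact (T ` D))" (is "?L \<longleftrightarrow> ?R")
proof
  assume ?L
  then show ?R
    using barrel_separated_not_precompact precompact_image_iff_sup_on[OF T \<phi>] by blast
next
  assume R: ?R
  show ?L
  proof (intro allI impI notI)
    fix B
    assume B: "barrel_bounded smul B \<and> \<not> barrel_precompact smul B"
      and lim: "(\<lambda>n. sup_on B (\<phi> n)) \<longlonglongrightarrow> 0"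
    then obtain D where D: "D \<subseteq> B" "infinite D" "barrel_separated smul D"
      using not_barrel_precompact_separated_subset by blast
    have "precompact (T ` B)"
      using B lim precompact_image_iff_sup_on[OF T \<phi>] by blast
    then have "precompact (T ` D)"
      using D(1) unfolding precompact_def by (meson image_mono order_trans)
    with R D B barrel_bounded_subset show False by blast
  qed
qed

text \<open>The norm of \<open>c0\<close> is defined as this very supremum, so additivity of each
  \<open>\<phi> n\<close> suffices.\<close>

lemma SUP_norm_diff_eq_dist:
  fixes T :: "'a \<Rightarrow> 'k c0"
  assumes T: "\<And>x n. coord (T x) n = \<phi> n x" and \<phi>: "weak_star_null smul \<phi>"
  shows "(SUP n. norm (\<phi> n (x - x'))) = dist (T x) (T x')"
proof -
  have "\<phi> n (x - x') = \<phi> n x - \<phi> n x'" for n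
    using \<phi> dual_linear(1)[of "\<phi> n" smul "x - x'" x'] by (simp add: weak_star_null_iff)
  then show ?thesis
    by (simp add: dist_norm norm_c0_def minus_c0.rep_eq T)
qed

text \<open>Sequences and operators determine each other through coordinates, so existence transfers
  for any predicates that agree on corresponding pairs. Both equivalences of the theorem are
  instances.\<close>

lemma ex_weak_star_null_iff_ex_operator:
  assumes "\<And>\<phi> (T :: 'a \<Rightarrow> 'k c0). weak_star_null smul \<phi> \<Longrightarrow> (\<And>x n. coord (T x) n = \<phi> n x) \<Longrightarrow>
    P \<phi> \<longleftrightarrow> Q T"
  shows "(\<exists>\<phi>. weak_star_null smul \<phi> \<and> P \<phi>) \<longleftrightarrow>
    (\<exists>T :: 'a \<Rightarrow> 'k c0. Vector_Spaces.linear smul scale_c0 T \<and>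
      continuous_map euclidean Cp0_topology T \<and> Q T)"
proof
  assume "\<exists>\<phi>. weak_star_null smul \<phi> \<and> P \<phi>"
  then obtain \<phi> where \<phi>: "weak_star_null smul \<phi>" "P \<phi>" by blast
  \<comment> \<open>\<open>Abs_c0\<close> is meaningful here because weak* nullity makes
    \<open>\<phi> n x\<close> a null sequence for every \<open>x\<close>.\<close>
  have T: "coord (Abs_c0 (\<lambda>n. \<phi> n x)) n = \<phi> n x" for x n
    using \<phi>(1) by (simp add: weak_star_null_iff coord_Abs_c0)
  show "\<exists>T :: 'a \<Rightarrow> 'k c0. Vector_Spaces.linear smul scale_c0 T \<and>
      continuous_map euclidean Cp0_topology T \<and> Q T"
    using weak_star_null_coord_iff[of "\<lambda>x. Abs_c0 (\<lambda>n. \<phi> n x)" \<phi>, OF T] assms[OF \<phi>(1) T] \<phi>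
    by blast
next
  assume "\<exists>T :: 'a \<Rightarrow> 'k c0. Vector_Spaces.linear smul scale_c0 T \<and>
      continuous_map euclidean Cp0_topology T \<and> Q T"
  then obtain T :: "'a \<Rightarrow> 'k c0" where T: "Vector_Spaces.linear smul scale_c0 T"
      "continuous_map euclidean Cp0_topology T" "Q T" by blast
  let ?\<phi> = "\<lambda>n x. coord (T x) n"
  have "weak_star_null smul ?\<phi>"
    using weak_star_null_coord_iff[of T ?\<phi>] T by blast
  then show "\<exists>\<phi>. weak_star_null smul \<phi> \<and> P \<phi>"
    using assms[of ?\<phi> T] T(3) by blast
qed

end

theorem theorem2p3:
  fixes smul :: "'k::real_or_complex \<Rightarrow> 'a::{topological_ab_group_add, t2_space} \<Rightarrow> 'a"
  assumes "locally_convex_space smul"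
  shows
    "let
       i = strong_Gelfand_Phillips smul;
       ii = (\<exists>\<phi>. weak_star_null smul \<phi> \<and>
         (\<forall>D. infinite D \<and> barrel_bounded smul D \<and> barrel_separated smul D \<longrightarrow>
           (\<exists>D0 \<delta>. D0 \<subseteq> D \<and> infinite D0 \<and> \<delta> > 0 \<and>
             (\<forall>x\<in>D0. \<forall>x'\<in>D0. x \<noteq> x' \<longrightarrow> (SUP n. norm (\<phi> n (x - x'))) > \<delta>))));
       iii = (\<exists>T :: 'a \<Rightarrow> 'k c0.
         Vector_Spaces.linear smul scale_c0 T \<and> continuous_map euclidean Cp0_topology T \<and>
         (\<forall>D. infinite D \<and> barrel_bounded smul D \<and> barrel_separated smul D \<longrightarrow>
           \<not> precompact (T ` D)))
     in (i \<longleftrightarrow> ii) \<and> (ii \<longleftrightarrow> iii)"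
proof -
  interpret locally_convex_space smul by (rule assms)
  let ?iii = "\<exists>T :: 'a \<Rightarrow> 'k c0.
    Vector_Spaces.linear smul scale_c0 T \<and> continuous_map euclidean Cp0_topology T \<and>
    (\<forall>D. infinite D \<and> barrel_bounded smul D \<and> barrel_separated smul D \<longrightarrow>
      \<not> precompact (T ` D))"
  have "strong_Gelfand_Phillips smul \<longleftrightarrow> ?iii"
    unfolding strong_Gelfand_Phillips_def
    by (rule ex_weak_star_null_iff_ex_operator) (rule detects_separated_iff)
  moreover have "(\<exists>\<phi>. weak_star_null smul \<phi> \<and>
      (\<forall>D. infinite D \<and> barrel_bounded smul D \<and> barrel_separated smul D \<longrightarrow>
        (\<exists>D0 \<delta>. D0 \<subseteq> D \<and> infinite D0 \<and> \<delta> > 0 \<and>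
          (\<forall>x\<in>D0. \<forall>x'\<in>D0. x \<noteq> x' \<longrightarrow> (SUP n. norm (\<phi> n (x - x'))) > \<delta>)))) \<longleftrightarrow> ?iii"
  proof (rule ex_weak_star_null_iff_ex_operator)
    fix \<phi> and T :: "'a \<Rightarrow> 'k c0"
    assume \<phi>: "weak_star_null smul \<phi>" and T: "\<And>x n. coord (T x) n = \<phi> n x"
    show "(\<forall>D. infinite D \<and> barrel_bounded smul D \<and> barrel_separated smul D \<longrightarrow>
        (\<exists>D0 \<delta>. D0 \<subseteq> D \<and> infinite D0 \<and> \<delta> > 0 \<and>
          (\<forall>x\<in>D0. \<forall>x'\<in>D0. x \<noteq> x' \<longrightarrow> (SUP n. norm (\<phi> n (x - x'))) > \<delta>))) \<longleftrightarrow>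
      (\<forall>D. infinite D \<and> barrel_bounded smul D \<and> barrel_separated smul D \<longrightarrow>
        \<not> precompact (T ` D))"
      \<comment> \<open>The two conditions agree for each \<open>D\<close> separately: the suprema
        are distances between images under \<open>T\<close>.\<close>
      by (simp only: not_precompact_image_iff_separated SUP_norm_diff_eq_dist[OF T \<phi>])
  qed
  ultimately show ?thesis
    unfolding Let_def by blast
qed

end
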